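(* Fix a prime $p$. Let $X_{\mathrm{Sel}_p}$ be a $\mathbb{Z}_{\ge0}$-valued random variable with $\mathrm{Prob}(X_{\mathrm{Sel}_p}=d)=c\prod_{j=1}^d\frac{p}{p^j-1}$, where $c=\prod_{j\ge0}(1+p^{-j})^{-1}$. For $r\in\mathbb{Z}_{\ge0}$ let $X_{\text{Ш}[p],r}$ be a random variable with values in $2\mathbb{Z}_{\ge0}$ such that $\mathrm{Prob}(X_{\text{Ш}[p],r}=2n)=p^{-n(2r+2n-1)}\frac{\prod_{i=n+1}^\infty(1-p^{-(2r+2i-1)})}{\prod_{i=1}^n(1-p^{-2i})}$ for $n\in\mathbb{Z}_{\ge0}$. For a $\mathbb{Z}_{\ge0}$-valued random variable $R$, let $R+X_{\text{Ш}[p],R}$ denote the random variable with $\mathrm{Prob}(R+X_{\text{Ш}[p],R}=s)=\sum_{r\ge0}\mathrm{Prob}(R=r)\,\mathrm{Prob}(X_{\text{Ш}[p],r}=s-r)$. Then, up to equality of distributions, the unique $\mathbb{Z}_{\ge0}$-valued random variable $R$ such that $X_{\mathrm{Sel}_p}$ and $R+X_{\text{Ш}[p],R}$ have the same distribution is the one taking the values $0$ and $1$ each with probability $1/2$. *)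

theory Defs
  imports "HOL-Probability.Probability" "HOL-Computational_Algebra.Primes"
begin

text \<open>
  Random variables with values in the non-negative integers matter here only up to equality of
  distributions, so they are represented by their distributions, of type \<^typ>\<open>nat pmf\<close>;
  equality of distributions is then equality of \<^typ>\<open>nat pmf\<close>.
\<close>

definition sel_mass :: "nat \<Rightarrow> nat \<Rightarrow> real" where
  "sel_mass p d =
     (\<Prod>j. inverse (1 + real p powi - int j)) * (\<Prod>j=1..d. real p / (real p ^ j - 1))"

text \<open>
  \<open>sha_mass p r n\<close> is the probability of the value \<open>2 * n\<close>, not of \<open>n\<close>. The infinite product over
  \<open>i \<ge> n + 1\<close> is reindexed by \<open>i = n + 1 + k\<close>. Exponents are integers, so nothing is truncated.
\<close>

definition sha_mass :: "nat \<Rightarrow> nat \<Rightarrow> nat \<Rightarrow> real" where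
  "sha_mass p r n =
     real p powi - (int n * (2 * int r + 2 * int n - 1)) *
     ((\<Prod>k. 1 - real p powi - (2 * int r + 2 * int (n + 1 + k) - 1)) /
      (\<Prod>i=1..n. 1 - real p powi - (2 * int i)))"

text \<open>
  The distribution of \<open>R + X\<^sub>R\<close> for a family \<open>X\<close> of distributions. A negative difference \<open>s - r\<close>
  has probability \<open>0\<close>. That this is a probability distribution is shown below.
\<close>

definition plus_family :: "nat pmf \<Rightarrow> (nat \<Rightarrow> nat pmf) \<Rightarrow> nat pmf" where
  "plus_family R X =
     embed_pmf (\<lambda>s. \<Sum>r. pmf R r * (if r \<le> s then pmf (X r) (s - r) else 0))"

lemma plus_family_aux:
  "(\<Sum>r. pmf R r * (if r \<le> s then pmf (X r) (s - r) else 0)) =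
   pmf (bind_pmf R (\<lambda>r. map_pmf ((+) r) (X r))) s"
proof -
  have eq: "pmf (map_pmf ((+) r) (X r)) s = (if r \<le> s then pmf (X r) (s - r) else 0)" for r
  proof (cases "r \<le> s")
    case True
    have "pmf (map_pmf ((+) r) (X r)) (r + (s - r)) = pmf (X r) (s - r)"
      by (rule pmf_map_inj') (simp add: inj_def)
    with True show ?thesis by simp
  next
    case False
    then have "s \<notin> set_pmf (map_pmf ((+) r) (X r))" by auto
    with False show ?thesis by (simp add: pmf_eq_0_set_pmf)
  qed
  have supp: "finite {..s}" "\<And>r. r \<notin> {..s} \<Longrightarrow>
      pmf R r * (if r \<le> s then pmf (X r) (s - r) else 0) = 0"
    by auto
  have "pmf (bind_pmf R (\<lambda>r. map_pmf ((+) r) (X r))) s =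
        measure_pmf.expectation R (\<lambda>r. if r \<le> s then pmf (X r) (s - r) else 0)"
    by (simp add: pmf_bind eq)
  also have "\<dots> = (\<Sum>r\<in>{..s}. pmf R r * (if r \<le> s then pmf (X r) (s - r) else 0))"
    by (subst integral_measure_pmf_real[of "{..s}"]) (auto simp: mult.commute split: if_splits)
  also have "\<dots> = (\<Sum>r. pmf R r * (if r \<le> s then pmf (X r) (s - r) else 0))"
    using suminf_finite[OF supp] by simp
  finally show ?thesis by simp
qed

lemma pmf_plus_family:
  "pmf (plus_family R X) s = (\<Sum>r. pmf R r * (if r \<le> s then pmf (X r) (s - r) else 0))"
proof -
  have "plus_family R X = bind_pmf R (\<lambda>r. map_pmf ((+) r) (X r))"
    unfolding plus_family_def plus_family_aux
    by (intro pmf_eqI pmf_embed_pmf) (simp_all add: nn_integral_pmf measure_pmf.emeasure_space_1[simplified])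
  then show ?thesis by (simp add: plus_family_aux)
qed

end

theory Submission imports Defs begin

text \<open>
  Put \<open>q = 1 / p\<close>. Only the summand \<open>r = s mod 2\<close> contributes to the probability that
  \<open>R + X\<^sub>R = s\<close> when \<open>R\<close> is uniform on \<open>{0, 1}\<close>, and the two masses agree by Euler's identity
  \<open>(\<Prod>j\<ge>1. 1 + q ^ j) * (\<Prod>i\<ge>1. 1 - q ^ (2 * i - 1)) = 1\<close>.
  Uniqueness holds because \<open>R \<mapsto> R + X\<^sub>R\<close> is a triangular linear map on distributions whose
  diagonal entries, the probabilities that \<open>X\<^sub>r = 0\<close>, do not vanish.
\<close>

lemma plus_family_sum:
  "pmf (plus_family R X) s = (\<Sum>r\<le>s. pmf R r * pmf (X r) (s - r))"
proof -
  have "pmf (plus_family R X) s = (\<Sum>r\<le>s. pmf R r * (if r \<le> s then pmf (X r) (s - r) else 0))"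
    unfolding pmf_plus_family by (rule suminf_finite) auto
  then show ?thesis by (auto intro!: sum.cong)
qed

lemma inj_plus_family:
  assumes "\<And>r. pmf (X r) 0 \<noteq> 0"
  shows "inj (\<lambda>R. plus_family R X)"
proof (rule injI)
  fix R R' assume eq: "plus_family R X = plus_family R' X"
  have "pmf R s = pmf R' s" for s
  proof (induction s rule: less_induct)
    case (less s)
    \<comment> \<open>Turning \<open>{..s}\<close> into \<open>{..<Suc s}\<close> splits off the
      diagonal term \<open>r = s\<close>. The terms below it agree by the induction hypothesis and
      cancel.\<close>
    have "pmf R s * pmf (X s) 0 = pmf R' s * pmf (X s) 0"
      using arg_cong[OF eq, of "\<lambda>M. pmf M s"] less
      by (simp add: plus_family_sum flip: lessThan_Suc_atMost)
    with assms show ?case by simp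
  qed
  then show "R = R'" by (rule pmf_eqI)
qed

lemma pmf_plus_family_uniform:
  assumes "\<And>r. set_pmf (X r) \<subseteq> {x. even x}"
  shows "pmf (plus_family (pmf_of_set {0, 1}) X) s = pmf (X (s mod 2)) (2 * (s div 2)) / 2"
proof -
  have odd: "pmf (X r) x = 0" if "odd x" for r x
    using assms[of r] that by (auto simp: pmf_eq_0_set_pmf)
  have "pmf (plus_family (pmf_of_set {0, 1}) X) s =
      (\<Sum>r\<le>s. if r \<in> {0, 1} then pmf (X r) (s - r) / 2 else 0)"
    unfolding plus_family_sum by (intro sum.cong) (auto simp: pmf_of_set)
  also have "\<dots> = (\<Sum>r\<in>{..s} \<inter> {0, 1}. pmf (X r) (s - r) / 2)"
    by (rule sum.inter_restrict[symmetric]) simp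
  also have "\<dots> = pmf (X (s mod 2)) (2 * (s div 2)) / 2"
  \<comment> \<open>At \<open>s = 0\<close> the range \<open>{..s}\<close> misses \<open>1\<close>.
    For larger \<open>s\<close> both values of \<open>r\<close> occur, and \<open>s - r\<close> is
    even only for \<open>r = s mod 2\<close>.\<close>
  proof (cases "s = 0")
    case True
    then show ?thesis by simp
  next
    case False
    then have "{..s} \<inter> {0, 1} = {0, 1}" by auto
    with False show ?thesis
      by (cases "even s") (auto simp: odd odd_iff_mod_2_eq_one elim!: evenE oddE)
  qed
  finally show ?thesis .
qed

lemma summable_power_reindex:
  fixes q :: real and f :: "nat \<Rightarrow> nat"
  assumes "0 < q" "q < 1" "\<And>k. k \<le> f k"
  shows "summable (\<lambda>k. q ^ f k)"
proof (rule summable_comparison_test)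
  show "summable (\<lambda>k. q ^ k)" using assms by (simp add: summable_geometric)
  show "\<exists>N. \<forall>n\<ge>N. norm (q ^ f n) \<le> q ^ n"
    using assms by (auto intro!: power_decreasing)
qed

lemma convergent_prod_one_plus_power:
  fixes q :: real and f :: "nat \<Rightarrow> nat"
  assumes "0 < q" "q < 1" "\<And>k. k \<le> f k"
  shows "convergent_prod (\<lambda>k. 1 + q ^ f k)"
proof (rule summable_imp_convergent_prod_real)
  show "summable (\<lambda>k. \<bar>q ^ f k\<bar>)"
    using summable_power_reindex[OF assms] assms(1) by simp
  show "q ^ f k \<noteq> - 1" for k
    using zero_less_power[OF assms(1), of "f k"] by linarith
qed

text \<open>The case \<open>f 0 = 0\<close> gives a zero factor, so the proof goes through absolute
  convergence, which tolerates finitely many zeros.\<close>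

lemma convergent_prod_one_minus_power:
  fixes q :: real and f :: "nat \<Rightarrow> nat"
  assumes "0 < q" "q < 1" "\<And>k. k \<le> f k"
  shows "convergent_prod (\<lambda>k. 1 - q ^ f k)"
proof -
  have "summable (\<lambda>k. norm (- (q ^ f k)))"
    using summable_power_reindex[OF assms] assms by simp
  then have "abs_convergent_prod (\<lambda>k. 1 + - (q ^ f k))"
    by (simp add: abs_convergent_prod_conv_summable)
  then show ?thesis
    using abs_convergent_prod_imp_convergent_prod by fastforce
qed

text \<open>The strict bound \<open>k < f k\<close> makes every exponent positive, so no factor
  vanishes.\<close>

lemma prodinf_one_minus_power_nonzero:
  fixes q :: real and f :: "nat \<Rightarrow> nat"
  assumes "0 < q" "q < 1" "\<And>k. k < f k"
  shows "(\<Prod>k. 1 - q ^ f k) \<noteq> 0"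
proof (rule prodinf_nonzero)
  show "convergent_prod (\<lambda>k. 1 - q ^ f k)"
    using assms by (intro convergent_prod_one_minus_power) (auto intro: less_imp_le)
  show "1 - q ^ f k \<noteq> 0" for k
    using power_Suc_less_one[of q "f k - 1"] assms(1,2) assms(3)[of k] by simp
qed

lemma convergent_prod_LIMSEQ_lessThan:
  fixes f :: "nat \<Rightarrow> real"
  assumes "convergent_prod f"
  shows "(\<lambda>n. \<Prod>k<n. f k) \<longlonglongrightarrow> prodinf f"
  using convergent_prod_LIMSEQ[OF assms] by (simp add: LIMSEQ_lessThan_iff_atMost)

text \<open>The exponents \<open>1, ..., 2 * n + r\<close> are sorted by parity;
  \<open>r = 1\<close> contributes one more odd exponent, \<open>2 * n + 1\<close>.\<close>

lemma prod_one_minus_power_split: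
  fixes q :: "'a :: comm_ring_1"
  assumes "r \<le> 1"
  shows "(\<Prod>j<2 * n + r. 1 - q ^ Suc j) =
    (\<Prod>j<n. 1 - q ^ (2 * Suc j)) * (\<Prod>k<n + r. 1 - q ^ (2 * k + 1))"
proof -
  have "(\<Prod>j<2 * n. 1 - q ^ Suc j) =
    (\<Prod>j<n. 1 - q ^ (2 * Suc j)) * (\<Prod>k<n. 1 - q ^ (2 * k + 1))"
    by (induction n) (simp_all add: mult_ac)
  moreover have "r = 0 \<or> r = 1" using assms by auto
  ultimately show ?thesis by (auto simp: mult_ac)
qed

text \<open>Since \<open>(1 + q ^ j) * (1 - q ^ j) = 1 - q ^ (2 * j)\<close>, the even exponents in
  \<open>P (2 * n)\<close> contribute \<open>P n\<close> times the product of the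
  \<open>1 + q ^ j\<close>. Hence the partial products equal \<open>P (2 * n) / P n\<close>, whose
  numerator and denominator share the nonzero limit \<open>L\<close>.\<close>

lemma euler_odd_distinct:
  fixes q :: real
  assumes q: "0 < q" "q < 1"
  shows "(\<Prod>j. 1 + q ^ Suc j) * (\<Prod>k. 1 - q ^ (2 * k + 1)) = 1"
proof -
  define P where "P = (\<lambda>n. \<Prod>j<n. 1 - q ^ Suc j)"
  define L where "L = (\<Prod>j. 1 - q ^ Suc j)"
  have nz: "1 - q ^ Suc j \<noteq> 0" for j
    using power_Suc_less_one[of q j] q by simp
  have P: "P \<longlonglongrightarrow> L"
    unfolding P_def L_def
    by (intro convergent_prod_LIMSEQ_lessThan convergent_prod_one_minus_power q) auto
  have L: "L \<noteq> 0"
    unfolding L_def by (rule prodinf_one_minus_power_nonzero[OF q]) auto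
  have "(\<lambda>n. (\<Prod>j<n. 1 + q ^ Suc j) * (\<Prod>k<n. 1 - q ^ (2 * k + 1)))
      \<longlonglongrightarrow> (\<Prod>j. 1 + q ^ Suc j) * (\<Prod>k. 1 - q ^ (2 * k + 1))"
    by (intro tendsto_mult convergent_prod_LIMSEQ_lessThan convergent_prod_one_plus_power
        convergent_prod_one_minus_power q) auto
  moreover have "(\<Prod>j<n. 1 + q ^ Suc j) * (\<Prod>k<n. 1 - q ^ (2 * k + 1)) = P (2 * n) / P n" for n
  proof -
    have "(\<Prod>j<n. 1 - q ^ (2 * Suc j)) = (\<Prod>j<n. 1 + q ^ Suc j) * P n"
      unfolding P_def prod.distrib[symmetric]
      by (intro prod.cong) (simp_all add: algebra_simps mult_2_right flip: power_add)
    moreover have "P n \<noteq> 0" using nz by (simp add: P_def)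
    ultimately show ?thesis
      using prod_one_minus_power_split[of 0 q n] by (simp add: P_def)
  qed
  moreover have "(\<lambda>n. P (2 * n) / P n) \<longlonglongrightarrow> L / L"
    using P L by (intro tendsto_divide filterlim_compose[OF P mult_nat_left_at_top]) auto
  ultimately show ?thesis
    using L LIMSEQ_unique by fastforce
qed

text \<open>In natural powers of \<open>1 / p\<close> the infinite product runs over odd exponents
  from \<open>2 * (n + r) + 1\<close> on, so it is a tail of the product in Euler's
  identity.\<close>

lemma sha_mass_inverse:
  "sha_mass p r n =
    real p powi - (int n * (2 * int r + 2 * int n - 1)) *
    ((\<Prod>k. 1 - inverse (real p) ^ (2 * (k + (n + r)) + 1)) /
     (\<Prod>j<n. 1 - inverse (real p) ^ (2 * Suc j)))"
proof -
  have "real p powi - (2 * int r + 2 * int (n + 1 + k) - 1) =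
      inverse (real p) ^ (2 * (k + (n + r)) + 1)" for k
  proof -
    have "2 * int r + 2 * int (n + 1 + k) - 1 = int (2 * (k + (n + r)) + 1)" by simp
    then show ?thesis
      by (simp only: power_int_minus power_int_of_nat power_inverse)
  qed
  moreover have "(\<Prod>i=1..n. 1 - real p powi - (2 * int i)) =
      (\<Prod>j<n. 1 - inverse (real p) ^ (2 * Suc j))"
  proof -
    have "real p powi - (2 * int i) = inverse (real p) ^ (2 * i)" for i
      using power_int_of_nat[of "real p" "2 * i"]
      by (simp add: power_int_minus power_inverse)
    then show ?thesis
      using prod.atLeast1_atMost_eq[of "\<lambda>i. 1 - inverse (real p) ^ (2 * i)" n] by simp
  qed
  ultimately show ?thesis unfolding sha_mass_def by simp
qed

text \<open>With \<open>q = inverse p\<close>, the factor at \<open>j + 1\<close> is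
  \<open>q ^ j / (1 - q ^ Suc j)\<close>, and the exponents \<open>0, ..., d - 1\<close> add up to
  \<open>d choose 2\<close>.\<close>

lemma prod_div_power_minus_one:
  fixes p :: real
  assumes "1 < p"
  shows "(\<Prod>j=1..d. p / (p ^ j - 1)) =
    inverse p ^ (d choose 2) / (\<Prod>j<d. 1 - inverse p ^ Suc j)"
proof (induction d)
  case 0
  then show ?case by (simp add: binomial_eq_0)
next
  case (Suc d)
  have "p ^ Suc d > 1" using assms by (simp del: power_Suc)
  then have "p / (p ^ Suc d - 1) = inverse p ^ d / (1 - inverse p ^ Suc d)"
    using assms by (simp add: field_simps)
  with Suc show ?case by (simp add: numeral_2_eq_2 power_add mult_ac)
qed

text \<open>By Euler's identity the constant \<open>c\<close> is half the full odd product
  \<open>T 0\<close>. Its initial segment \<open>D\<close> cancels the odd exponents in the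
  denominator of \<open>sel_mass\<close>, leaving the tail \<open>T (n + r)\<close> over the even
  ones, as in \<open>sha_mass\<close>.\<close>

lemma sel_mass_eq_half_sha_mass:
  assumes p: "1 < p" and r: "r \<le> 1"
  shows "sel_mass p (2 * n + r) = sha_mass p r n / 2"
proof -
  define q where "q = inverse (real p)"
  have q: "0 < q" "q < 1" using p by (auto simp: q_def field_simps)
  define T where "T = (\<lambda>m. \<Prod>k. 1 - q ^ (2 * (k + m) + 1))"
  define D where "D = (\<Prod>k<n + r. 1 - q ^ (2 * k + 1))"
  have nz: "1 - q ^ Suc j \<noteq> 0" for j
    using power_Suc_less_one[of q j] q by simp
  have D: "D \<noteq> 0" using nz by (simp add: D_def del: power_Suc)
  \<comment> \<open>The factor at \<open>j = 0\<close> is \<open>2\<close>; it becomes the weight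
    \<open>1 / 2\<close> of the uniform distribution.\<close>
  have "(\<Prod>j. 1 + q ^ j) = (\<Prod>j. 1 + q ^ Suc j) * 2"
    using prodinf_split_head[OF convergent_prod_one_plus_power[OF q, of "\<lambda>j. j"]] by simp
  also have "\<dots> * T 0 = 2"
    using euler_odd_distinct[OF q] by (simp add: T_def)
  finally have "(\<Prod>j. 1 + q ^ j) * (T 0 / 2) = 1" by simp
  then have c: "inverse (\<Prod>j. 1 + q ^ j) = T 0 / 2" by (rule inverse_unique)
  have "(\<Prod>j. inverse (1 + real p powi - int j)) = (\<Prod>j. inverse (1 + q ^ j))"
    by (simp add: power_int_minus q_def power_inverse)
  also have "\<dots> = T 0 / 2"
    using convergent_prod_one_plus_power[OF q, of "\<lambda>j. j"] c by (simp add: prodinf_inverse)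
  finally have c': "(\<Prod>j. inverse (1 + real p powi - int j)) = T 0 / 2" .
  have T: "T 0 = D * T (n + r)"
    unfolding T_def D_def
    using prodinf_split_initial_segment[of "\<lambda>k. 1 - q ^ (2 * k + 1)" "n + r"] nz
      convergent_prod_one_minus_power[OF q, of "\<lambda>k. 2 * k + 1"]
    by (simp add: mult_ac)
  \<comment> \<open>In general the two sides differ by \<open>r choose 2\<close>, which is
    \<open>0\<close> for \<open>r \<le> 1\<close>. The natural subtraction truncates only at
    \<open>n = r = 0\<close>, where the factor \<open>n\<close> hides it.\<close>
  have "(2 * n + r) choose 2 = n * (2 * n + 2 * r - 1)"
    using r unfolding choose_two by (cases r) (simp_all add: algebra_simps)
  moreover have "int n * (2 * int r + 2 * int n - 1) = int (n * (2 * n + 2 * r - 1))"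
    by (cases n) (simp_all add: algebra_simps)
  ultimately have e: "real p powi - (int n * (2 * int r + 2 * int n - 1)) = q ^ ((2 * n + r) choose 2)"
    by (simp only: q_def power_int_minus power_int_of_nat power_inverse)
  have "sel_mass p (2 * n + r) =
      T 0 / 2 * (q ^ ((2 * n + r) choose 2) / (\<Prod>j<2 * n + r. 1 - q ^ Suc j))"
    unfolding sel_mass_def c' using p by (subst prod_div_power_minus_one) (simp_all add: q_def)
  also have "(\<Prod>j<2 * n + r. 1 - q ^ Suc j) = (\<Prod>j<n. 1 - q ^ (2 * Suc j)) * D"
    unfolding D_def by (rule prod_one_minus_power_split[OF r])
  also have "T 0 / 2 * (q ^ ((2 * n + r) choose 2) / \<dots>) =
      q ^ ((2 * n + r) choose 2) * (T (n + r) / (\<Prod>j<n. 1 - q ^ (2 * Suc j))) / 2"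
    using D by (simp add: T mult_ac)
  also have "\<dots> = sha_mass p r n / 2"
    by (simp add: sha_mass_inverse e T_def flip: q_def)
  finally show ?thesis .
qed

theorem theorem5p2:
  fixes p :: nat and X_Sel :: "nat pmf" and X_Sha :: "nat \<Rightarrow> nat pmf"
  assumes "prime p"
    and "\<And>d. pmf X_Sel d = sel_mass p d"
    and "\<And>r. set_pmf (X_Sha r) \<subseteq> {x. even x}"
    and "\<And>r n. pmf (X_Sha r) (2 * n) = sha_mass p r n"
  shows "\<forall>R :: nat pmf. X_Sel = plus_family R X_Sha \<longleftrightarrow> R = pmf_of_set {0, 1}"
proof -
  have p: "1 < p" using assms(1) by (rule prime_gt_1_nat)
  \<comment> \<open>These are the diagonal entries: at \<open>n = 0\<close> the power of
    \<open>p\<close> and the finite product are \<open>1\<close>, and a nonzero infinite product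
    remains.\<close>
  have "pmf (X_Sha r) 0 \<noteq> 0" for r
    using assms(4)[of r 0] p
      prodinf_one_minus_power_nonzero[of "inverse (real p)" "\<lambda>k. 2 * (k + r) + 1"]
    by (simp add: sha_mass_inverse field_simps del: power_Suc)
  then have inj: "inj (\<lambda>R. plus_family R X_Sha)" by (rule inj_plus_family)
  have "X_Sel = plus_family (pmf_of_set {0, 1}) X_Sha"
  proof (rule pmf_eqI)
    fix s
    have "pmf X_Sel s = sel_mass p (2 * (s div 2) + s mod 2)" by (simp add: assms(2))
    also have "\<dots> = pmf (X_Sha (s mod 2)) (2 * (s div 2)) / 2"
      using p by (simp only: sel_mass_eq_half_sha_mass assms(4))
    also have "\<dots> = pmf (plus_family (pmf_of_set {0, 1}) X_Sha) s"
      using assms(3) by (rule pmf_plus_family_uniform[symmetric])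
    finally show "pmf X_Sel s = pmf (plus_family (pmf_of_set {0, 1}) X_Sha) s" .
  qed
  with inj show ?thesis by (auto dest: injD)
qed

end
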